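(* Let $\big( (\mathcal{G}, \{ \mu_k \}_{k \geq 1}) , (\mathcal{H}, \{ \nu_k \}_{k \geq 1}) , \{ \rho_k \}_{k \geq 1}, \{ \psi_k \}_{k \geq 1 } \big)$ be a matched pair of $L_\infty$-algebras. Then the direct sum $\mathcal{G} \oplus \mathcal{H}$ is an $L_\infty$-algebra with structure maps $\{ l_k : (\mathcal{G} \oplus \mathcal{H})^{\otimes k} \to \mathcal{G} \oplus \mathcal{H} \}_{k \geq 1}$ given by $$l_k \big( (x_1, h_1), \ldots, (x_k, h_k) \big) := \Big( \mu_k (x_1, \ldots, x_k) + \sum_{i=1}^k (-1)^{k-i} (-1)^{|x_i| ( |h_{i+1}| + \cdots + |h_k|)} \psi_k (h_1, \ldots, \widehat{h_i}, \ldots, h_k, x_i),$$ $$\nu_k (h_1, \ldots, h_k) + \sum_{i=1}^k (-1)^{k-i} (-1)^{|h_i| ( |x_{i+1}| + \cdots + |x_k|)} \rho_k (x_1, \ldots, \widehat{x_i}, \ldots, x_k, h_i) \Big),$$ for any $k \geq 1$ and homogeneous $(x_1, h_1), \ldots, (x_k, h_k) \in \mathcal{G} \oplus \mathcal{H}$.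
   Context: All graded vector spaces ($\mathbb{Z}$-graded) and maps are over a field $\mathbf{k}$ of characteristic zero; $(-1)^\sigma$ is the sign of a permutation and $\epsilon(\sigma)$ its Koszul sign on the given homogeneous elements; $\mathrm{Sh}(l,k-1)$ is the set of shuffles. A homogeneous element $(x,h)\in\mathcal{G}\oplus\mathcal{H}$ has $|x|=|h|$. An $L_\infty$-algebra $(\mathcal{G},\{\mu_k\}_{k\ge1})$ is a graded vector space with graded linear maps $\mu_k:\mathcal{G}^{\otimes k}\to\mathcal{G}$ of degree $k-2$ that are graded skew-symmetric, $\mu_k(x_1,\ldots,x_k)=(-1)^\sigma\epsilon(\sigma)\mu_k(x_{\sigma(1)},\ldots,x_{\sigma(k)})$, and satisfy for every $N\ge1$ and homogeneous $x_1,\ldots,x_N$: $$\sum_{k+l=N+1}\sum_{\sigma\in\mathrm{Sh}(l,k-1)}(-1)^\sigma\epsilon(\sigma)(-1)^{l(k-1)}\mu_k\big(\mu_l(x_{\sigma(1)},\ldots,x_{\sigma(l)}),x_{\sigma(l+1)},\ldots,x_{\sigma(N)}\big)=0.$$ Given $L_\infty$-algebras $(\mathcal{G},\{\mu_k\})$, $(\mathcal{H},\{\nu_k\})$ and maps $\rho_k:\mathcal{G}^{\otimes k-1}\otimes\mathcal{H}\to\mathcal{H}$ (graded skew-symmetric in the inputs of $\mathcal{G}$, degree $k-2$) and $\psi_k:\mathcal{H}^{\otimes k-1}\otimes\mathcal{G}\to\mathcal{G}$ (graded skew-symmetric in the inputs of $\mathcal{H}$, degree $k-2$), $k\ge1$,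 define graded skew-symmetric maps $(\mathcal{G}\oplus\mathcal{H})^{\otimes k}\to\mathcal{G}\oplus\mathcal{H}$ by $$(\mu_k\ltimes\rho_k)((x_1,h_1),\ldots,(x_k,h_k))=\Big(\mu_k(x_1,\ldots,x_k),\sum_{i=1}^k(-1)^{k-i}(-1)^{|h_i|(|x_{i+1}|+\cdots+|x_k|)}\rho_k(x_1,\ldots,\widehat{x_i},\ldots,x_k,h_i)\Big),$$ $$(\psi_k\rtimes\nu_k)((x_1,h_1),\ldots,(x_k,h_k))=\Big(\sum_{i=1}^k(-1)^{k-i}(-1)^{|x_i|(|h_{i+1}|+\cdots+|h_k|)}\psi_k(h_1,\ldots,\widehat{h_i},\ldots,h_k,x_i),\nu_k(h_1,\ldots,h_k)\Big).$$ $\{\rho_k\}$ is a representation of $(\mathcal{G},\{\mu_k\})$ on $\mathcal{H}$ if and only if $(\mathcal{G}\oplus\mathcal{H},\{\mu_k\ltimes\rho_k\})$ is an $L_\infty$-algebra, and $\{\psi_k\}$ is a representation of $(\mathcal{H},\{\nu_k\})$ on $\mathcal{G}$ if and only if $(\mathcal{G}\oplus\mathcal{H},\{\psi_k\rtimes\nu_k\})$ is an $L_\infty$-algebra. These data form a matched pair of $L_\infty$-algebras if: (i) $\{\rho_k\}$ is a representation of the $L_\infty$-algebra $\mathcal{G}$ on $\mathcal{H}$; (ii) $\{\psi_k\}$ is a representation of the $L_\infty$-algebra $\mathcal{H}$ on $\mathcal{G}$; (iii) for every $N\ge1$ and homogeneous $e_1,\ldots,e_N\in\mathcal{G}\oplus\mathcal{H}$,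 $$\sum_{k+l=N+1}\sum_{\sigma\in\mathrm{Sh}(l,k-1)}(-1)^\sigma\epsilon(\sigma)(-1)^{l(k-1)}\Big\{(\mu_k\ltimes\rho_k)\big((\psi_l\rtimes\nu_l)(e_{\sigma(1)},\ldots,e_{\sigma(l)}),e_{\sigma(l+1)},\ldots,e_{\sigma(N)}\big)$$ $$+(\psi_k\rtimes\nu_k)\big((\mu_l\ltimes\rho_l)(e_{\sigma(1)},\ldots,e_{\sigma(l)}),e_{\sigma(l+1)},\ldots,e_{\sigma(N)}\big)\Big\}=0.$$ *)

theory Defs
  imports
    "HOL-Analysis.Product_Vector"
    "HOL-Combinatorics.Permutations"
begin

section \<open>Graded vector spaces\<close>

text \<open>
  A \<open>\<int>\<close>-graded vector space is a vector space together with subspaces \<open>gr d\<close>, of which it is the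
  (internal) direct sum. The zero vector is homogeneous of every degree; accordingly, statements
  about homogeneous elements \<open>xs\<close> quantify over a list \<open>ds\<close> of degrees with \<open>homogeneous gr xs ds\<close>.
\<close>

definition is_decomposition :: "(int \<Rightarrow> 'v::ab_group_add set) \<Rightarrow> 'v \<Rightarrow> (int \<Rightarrow> 'v) \<Rightarrow> bool" where
  "is_decomposition gr v c \<longleftrightarrow>
     (\<forall>d. c d \<in> gr d) \<and> finite {d. c d \<noteq> 0} \<and> v = (\<Sum>d | c d \<noteq> 0. c d)"

locale graded_vector_space = vector_space scale
  for scale :: "'k::field_char_0 \<Rightarrow> 'v::ab_group_add \<Rightarrow> 'v" +
  fixes gr :: "int \<Rightarrow> 'v set"
  assumes subspace_gr: "subspace (gr d)"
    and ex1_decomposition: "\<exists>!c. is_decomposition gr v c"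

definition component :: "(int \<Rightarrow> 'v::ab_group_add set) \<Rightarrow> 'v \<Rightarrow> int \<Rightarrow> 'v" where
  "component gr v = (THE c. is_decomposition gr v c)"

definition homogeneous :: "(int \<Rightarrow> 'v set) \<Rightarrow> 'v list \<Rightarrow> int list \<Rightarrow> bool" where
  "homogeneous gr xs ds \<longleftrightarrow> list_all2 (\<lambda>x d. x \<in> gr d) xs ds"

text \<open>In the direct sum, \<open>(x, h)\<close> is homogeneous of degree \<open>d\<close> iff both \<open>x\<close> and \<open>h\<close> are.\<close>

definition gr_prod :: "(int \<Rightarrow> 'g set) \<Rightarrow> (int \<Rightarrow> 'h set) \<Rightarrow> int \<Rightarrow> ('g \<times> 'h) set" where
  "gr_prod gG gH d = gG d \<times> gH d"


section \<open>Signs and shuffles\<close>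

text \<open>Positions are counted from 0, so permutations act on \<open>{..<n}\<close>, and
  \<open>permute_list \<sigma> [x\<^sub>0, \<dots>] = [x\<^bsub>\<sigma> 0\<^esub>, \<dots>]\<close>.\<close>

text \<open>The Koszul sign, for elements of degrees \<open>ds\<close>: one factor for each pair of elements whose order
  is reversed when passing from \<open>xs\<close> to \<open>permute_list \<sigma> xs\<close>.\<close>

definition koszul_sign :: "(nat \<Rightarrow> nat) \<Rightarrow> int list \<Rightarrow> 'k::field_char_0" where
  "koszul_sign \<sigma> ds =
     (\<Prod>(i, j) \<in> {(i, j). i < j \<and> j < length ds \<and> \<sigma> j < \<sigma> i}. (-1) powi (ds ! \<sigma> i * ds ! \<sigma> j))"

definition skew_sign :: "(nat \<Rightarrow> nat) \<Rightarrow> int list \<Rightarrow> 'k::field_char_0" where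
  "skew_sign \<sigma> ds = of_int (sign \<sigma>) * koszul_sign \<sigma> ds"

definition Sh :: "nat \<Rightarrow> nat \<Rightarrow> (nat \<Rightarrow> nat) set" where
  "Sh p q = {\<sigma>. \<sigma> permutes {..<p + q} \<and> strict_mono_on {..<p} \<sigma> \<and> strict_mono_on {p..<p + q} \<sigma>}"


section \<open>\<open>L\<^sub>\<infinity>\<close>-algebras\<close>

text \<open>A linear map out of a \<open>k\<close>-fold tensor power is a \<open>k\<close>-linear map, here a function on lists that
  is only relevant on lists of length \<open>k\<close>.\<close>

definition multilinear ::
  "nat \<Rightarrow> ('k::field_char_0 \<Rightarrow> 'v::ab_group_add \<Rightarrow> 'v) \<Rightarrow> ('k \<Rightarrow> 'w::ab_group_add \<Rightarrow> 'w)
    \<Rightarrow> ('v list \<Rightarrow> 'w) \<Rightarrow> bool" where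
  "multilinear k s t f \<longleftrightarrow>
     (\<forall>xs i. length xs = k \<and> i < k \<longrightarrow> Vector_Spaces.linear s t (\<lambda>v. f (xs[i := v])))"

text \<open>\<open>jacobi_sum s N ds F\<close> is the signed sum over all \<open>k + l = N + 1\<close> and all \<open>(l, k - 1)\<close>-shuffles \<open>\<sigma>\<close>;
  \<open>nest f g k l\<close> feeds the first \<open>l\<close> of the (already permuted) inputs to \<open>g l\<close>, and its value with
  the remaining \<open>k - 1\<close> inputs to \<open>f k\<close>.\<close>

definition nest :: "(nat \<Rightarrow> 'v list \<Rightarrow> 'v) \<Rightarrow> (nat \<Rightarrow> 'v list \<Rightarrow> 'v) \<Rightarrow> nat \<Rightarrow> nat \<Rightarrow> 'v list \<Rightarrow> 'v" where
  "nest f g k l ys = f k (g l (take l ys) # drop l ys)"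

definition jacobi_sum ::
  "('k::field_char_0 \<Rightarrow> 'v::ab_group_add \<Rightarrow> 'v) \<Rightarrow> nat \<Rightarrow> int list \<Rightarrow> 'v list
    \<Rightarrow> (nat \<Rightarrow> nat \<Rightarrow> 'v list \<Rightarrow> 'v) \<Rightarrow> 'v" where
  "jacobi_sum s N ds xs F =
     (\<Sum>(k, l) \<in> {(k, l). 1 \<le> k \<and> 1 \<le> l \<and> k + l = N + 1}.
        \<Sum>\<sigma> \<in> Sh l (k - 1). s (skew_sign \<sigma> ds * (-1) ^ (l * (k - 1))) (F k l (permute_list \<sigma> xs)))"

locale L_infinity_algebra = graded_vector_space scale gr
  for scale :: "'k::field_char_0 \<Rightarrow> 'v::ab_group_add \<Rightarrow> 'v" and gr :: "int \<Rightarrow> 'v set" +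
  fixes mu :: "nat \<Rightarrow> 'v list \<Rightarrow> 'v"
  assumes mu_multilinear: "k \<ge> 1 \<Longrightarrow> multilinear k scale scale (mu k)"
    and mu_degree: "\<lbrakk>k \<ge> 1; length xs = k; homogeneous gr xs ds\<rbrakk>
      \<Longrightarrow> mu k xs \<in> gr (sum_list ds + int k - 2)"
    and mu_skew: "\<lbrakk>k \<ge> 1; length xs = k; homogeneous gr xs ds; \<sigma> permutes {..<k}\<rbrakk>
      \<Longrightarrow> mu k xs = scale (skew_sign \<sigma> ds) (mu k (permute_list \<sigma> xs))"
    and mu_jacobi: "\<lbrakk>N \<ge> 1; length xs = N; homogeneous gr xs ds\<rbrakk>
      \<Longrightarrow> jacobi_sum scale N ds xs (nest mu mu) = 0"


section \<open>Matched pairs\<close>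

text \<open>Maps \<open>rho k\<close> of degree \<open>k - 2\<close> taking \<open>k - 1\<close> inputs from the first space, in which they are graded
  skew-symmetric, and one from the second, with values in the second.\<close>

locale graded_action_maps = G: graded_vector_space sG gG + H: graded_vector_space sH gH
  for sG :: "'k::field_char_0 \<Rightarrow> 'g::ab_group_add \<Rightarrow> 'g" and gG :: "int \<Rightarrow> 'g set"
    and sH :: "'k \<Rightarrow> 'h::ab_group_add \<Rightarrow> 'h" and gH :: "int \<Rightarrow> 'h set" +
  fixes rho :: "nat \<Rightarrow> 'g list \<Rightarrow> 'h \<Rightarrow> 'h"
  assumes act_multilinear: "k \<ge> 1 \<Longrightarrow> multilinear (k - 1) sG sH (\<lambda>xs. rho k xs h)"
    and act_linear: "\<lbrakk>k \<ge> 1; length xs = k - 1\<rbrakk> \<Longrightarrow> Vector_Spaces.linear sH sH (rho k xs)"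
    and act_degree: "\<lbrakk>k \<ge> 1; length xs = k - 1; homogeneous gG xs ds; h \<in> gH d\<rbrakk>
      \<Longrightarrow> rho k xs h \<in> gH (sum_list ds + d + int k - 2)"
    and act_skew: "\<lbrakk>k \<ge> 1; length xs = k - 1; homogeneous gG xs ds; \<sigma> permutes {..<k - 1}\<rbrakk>
      \<Longrightarrow> rho k xs h = sH (skew_sign \<sigma> ds) (rho k (permute_list \<sigma> xs) h)"

text \<open>The sum \<open>\<Sum>\<^sub>i (-1)\<^bsup>k-i\<^esup> (-1)\<^bsup>|h\<^sub>i|(|x\<^bsub>i+1\<^esub>|+\<dots>+|x\<^sub>k|)\<^esup> \<rho>\<^sub>k(x\<^sub>1, \<dots>, x\<^sub>i omitted, \<dots>, x\<^sub>k, h\<^sub>i)\<close> for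
  \<open>|x\<^sub>i| = |h\<^sub>i| = ds ! i\<close>, with \<open>i\<close> shifted to start at 0.\<close>

definition action_sum ::
  "('k::field_char_0 \<Rightarrow> 'h::ab_group_add \<Rightarrow> 'h) \<Rightarrow> (nat \<Rightarrow> 'g list \<Rightarrow> 'h \<Rightarrow> 'h) \<Rightarrow> nat
    \<Rightarrow> int list \<Rightarrow> 'g list \<Rightarrow> 'h list \<Rightarrow> 'h" where
  "action_sum s rho k ds xs hs =
     (\<Sum>i<k. s ((-1) ^ (k - 1 - i) * (-1) powi (ds ! i * sum_list (drop (Suc i) ds)))
               (rho k (take i xs @ drop (Suc i) xs) (hs ! i)))"

text \<open>Formulas involving the degrees of the inputs only make sense on homogeneous elements. If
  \<open>f ds\<close> gives the values on elements of degrees \<open>ds\<close>, then \<open>extend gr f\<close> is the multilinear extension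
  to arbitrary elements: it decomposes all inputs and sums over all choices of (nonzero)
  components.\<close>

definition extend ::
  "(int \<Rightarrow> 'v::ab_group_add set) \<Rightarrow> (int list \<Rightarrow> 'v list \<Rightarrow> 'w::comm_monoid_add) \<Rightarrow> 'v list \<Rightarrow> 'w" where
  "extend gr f es =
     (\<Sum>ds | list_all2 (\<lambda>e d. component gr e d \<noteq> 0) es ds. f ds (map2 (component gr) es ds))"

definition left_semidirect ::
  "(int \<Rightarrow> 'g::ab_group_add set) \<Rightarrow> ('k::field_char_0 \<Rightarrow> 'h::ab_group_add \<Rightarrow> 'h) \<Rightarrow> (int \<Rightarrow> 'h set)
    \<Rightarrow> (nat \<Rightarrow> 'g list \<Rightarrow> 'g) \<Rightarrow> (nat \<Rightarrow> 'g list \<Rightarrow> 'h \<Rightarrow> 'h)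
    \<Rightarrow> nat \<Rightarrow> ('g \<times> 'h) list \<Rightarrow> 'g \<times> 'h" where
  "left_semidirect gG sH gH mu rho k = extend (gr_prod gG gH) (\<lambda>ds es.
     (mu k (map fst es), action_sum sH rho k ds (map fst es) (map snd es)))"

definition right_semidirect ::
  "('k::field_char_0 \<Rightarrow> 'g::ab_group_add \<Rightarrow> 'g) \<Rightarrow> (int \<Rightarrow> 'g set) \<Rightarrow> (int \<Rightarrow> 'h::ab_group_add set)
    \<Rightarrow> (nat \<Rightarrow> 'h list \<Rightarrow> 'g \<Rightarrow> 'g) \<Rightarrow> (nat \<Rightarrow> 'h list \<Rightarrow> 'h)
    \<Rightarrow> nat \<Rightarrow> ('g \<times> 'h) list \<Rightarrow> 'g \<times> 'h" where
  "right_semidirect sG gG gH psi nu k = extend (gr_prod gG gH) (\<lambda>ds es.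
     (action_sum sG psi k ds (map snd es) (map fst es), nu k (map snd es)))"

definition matched_sum ::
  "('k::field_char_0 \<Rightarrow> 'g::ab_group_add \<Rightarrow> 'g) \<Rightarrow> (int \<Rightarrow> 'g set)
    \<Rightarrow> ('k \<Rightarrow> 'h::ab_group_add \<Rightarrow> 'h) \<Rightarrow> (int \<Rightarrow> 'h set)
    \<Rightarrow> (nat \<Rightarrow> 'g list \<Rightarrow> 'g) \<Rightarrow> (nat \<Rightarrow> 'h list \<Rightarrow> 'h)
    \<Rightarrow> (nat \<Rightarrow> 'g list \<Rightarrow> 'h \<Rightarrow> 'h) \<Rightarrow> (nat \<Rightarrow> 'h list \<Rightarrow> 'g \<Rightarrow> 'g)
    \<Rightarrow> nat \<Rightarrow> ('g \<times> 'h) list \<Rightarrow> 'g \<times> 'h" where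
  "matched_sum sG gG sH gH mu nu rho psi k = extend (gr_prod gG gH) (\<lambda>ds es.
     (mu k (map fst es) + action_sum sG psi k ds (map snd es) (map fst es),
      nu k (map snd es) + action_sum sH rho k ds (map fst es) (map snd es)))"

text \<open>That \<open>rho\<close> (resp. \<open>psi\<close>) is a representation means that the corresponding semidirect product is
  an \<open>L\<^sub>\<infinity>\<close>-algebra. \<open>module_prod.scale sG sH\<close> is the componentwise scalar multiplication.\<close>

locale matched_pair =
  G: L_infinity_algebra sG gG mu + H: L_infinity_algebra sH gH nu +
  rho: graded_action_maps sG gG sH gH rho + psi: graded_action_maps sH gH sG gG psi
  for sG :: "'k::field_char_0 \<Rightarrow> 'g::ab_group_add \<Rightarrow> 'g" and gG :: "int \<Rightarrow> 'g set"
    and mu :: "nat \<Rightarrow> 'g list \<Rightarrow> 'g"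
    and sH :: "'k \<Rightarrow> 'h::ab_group_add \<Rightarrow> 'h" and gH :: "int \<Rightarrow> 'h set"
    and nu :: "nat \<Rightarrow> 'h list \<Rightarrow> 'h"
    and rho :: "nat \<Rightarrow> 'g list \<Rightarrow> 'h \<Rightarrow> 'h" and psi :: "nat \<Rightarrow> 'h list \<Rightarrow> 'g \<Rightarrow> 'g" +
  assumes rho_representation:
      "L_infinity_algebra (module_prod.scale sG sH) (gr_prod gG gH) (left_semidirect gG sH gH mu rho)"
    and psi_representation:
      "L_infinity_algebra (module_prod.scale sG sH) (gr_prod gG gH) (right_semidirect sG gG gH psi nu)"
    and compatibility:
      "\<lbrakk>N \<ge> 1; length es = N; homogeneous (gr_prod gG gH) es ds\<rbrakk> \<Longrightarrow>
        jacobi_sum (module_prod.scale sG sH) N ds es (\<lambda>k l ys.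
          nest (left_semidirect gG sH gH mu rho) (right_semidirect sG gG gH psi nu) k l ys +
          nest (right_semidirect sG gG gH psi nu) (left_semidirect gG sH gH mu rho) k l ys) = 0"

end

theory Submission
  imports Defs
begin

text \<open>
  The maps \<open>l\<^sub>k\<close> are the sums of the two semidirect product structures \<open>\<mu>\<^sub>k \<ltimes> \<rho>\<^sub>k\<close> and \<open>\<psi>\<^sub>k \<rtimes> \<nu>\<^sub>k\<close>, both of
  which are \<open>L\<^sub>\<infinity>\<close>-structures. By linearity in the first input, the Jacobi sum of a sum of two structures
  is the sum of the two Jacobi sums and of the mixed one, and condition (iii) of a matched pair says
  that the latter vanishes.
\<close>

lemma multilinear_linear:
  "\<lbrakk>multilinear k s t f; length xs = k; i < k\<rbrakk> \<Longrightarrow> Vector_Spaces.linear s t (\<lambda>v. f (xs[i := v]))"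
  unfolding multilinear_def by blast

lemma multilinear_zero:
  assumes "multilinear k s t f" "length xs = k" "0 \<in> set xs"
  shows "f xs = 0"
proof -
  obtain i where i: "i < k" "xs ! i = 0"
    using assms by (auto simp: in_set_conv_nth)
  interpret Vector_Spaces.linear s t "\<lambda>v. f (xs[i := v])"
    using multilinear_linear[OF assms(1,2) i(1)] .
  show ?thesis
    using zero i by (metis list_update_id)
qed

lemma multilinear_Cons_add:
  assumes "multilinear k s t f" "Suc (length ys) = k"
  shows "f ((a + b) # ys) = f (a # ys) + f (b # ys)"
proof -
  \<comment> \<open>The head \<open>0\<close> is a placeholder: the update at position 0 overwrites
    it, which turns linearity in slot 0 into a statement about \<open>v # ys\<close>.\<close>
  interpret Vector_Spaces.linear s t "\<lambda>v. f ((0 # ys)[0 := v])"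
    by (rule multilinear_linear[OF assms(1)]) (use assms(2) in auto)
  show ?thesis
    using add[of a b] by simp
qed

lemma multilinear_plus:
  assumes f: "multilinear k s t f" and g: "multilinear k s t g"
  shows "multilinear k s t (\<lambda>xs. f xs + g xs)"
proof -
  have "Vector_Spaces.linear s t (\<lambda>v. f (xs[i := v]) + g (xs[i := v]))"
    if xs: "length xs = k" "i < k" for xs i
  proof -
    interpret f: Vector_Spaces.linear s t "\<lambda>v. f (xs[i := v])"
      using multilinear_linear[OF f xs] .
    interpret g: Vector_Spaces.linear s t "\<lambda>v. g (xs[i := v])"
      using multilinear_linear[OF g xs] .
    interpret vector_space_pair s t
      by unfold_locales
    show ?thesis
      by (rule linear_compose_add) unfold_locales
  qed
  then show ?thesis
    unfolding multilinear_def by blast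
qed

context graded_vector_space
begin

lemma component_homogeneous:
  assumes "v \<in> gr d"
  shows "component gr v = (\<lambda>d'. if d' = d then v else 0)"
  unfolding component_def
proof (rule the1_equality[OF ex1_decomposition])
  \<comment> \<open>For \<open>v = 0\<close> the support is empty, and the empty sum still gives
    \<open>v\<close>.\<close>
  have supp: "{d'. (if d' = d then v else 0) \<noteq> 0} = (if v = 0 then {} else {d})"
    by auto
  show "is_decomposition gr v (\<lambda>d'. if d' = d then v else 0)"
    using assms subspace_0[OF subspace_gr] unfolding is_decomposition_def supp by auto
qed

text \<open>A nonzero homogeneous entry has exactly one nonzero component, so without zero entries
  \<open>ds\<close> is the only index of the sum. A zero entry has no nonzero component, so the sum
  is empty. Since zero has every degree, \<open>ds\<close> is then not determined by
  \<open>es\<close>, and the second hypothesis makes \<open>f ds es\<close> agree with the empty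
  sum.\<close>

lemma extend_homogeneous:
  assumes "homogeneous gr es ds" and "0 \<in> set es \<Longrightarrow> f ds es = 0"
  shows "extend gr f es = f ds es"
proof (cases "0 \<in> set es")
  case True
  then have "\<not> list_all2 (\<lambda>e d. component gr e d \<noteq> 0) es ds'" for ds'
    using component_homogeneous[OF subspace_0[OF subspace_gr]]
    by (fastforce simp: list_all2_conv_all_nth in_set_conv_nth)
  then show ?thesis
    using assms(2)[OF True] by (simp add: extend_def)
next
  case False
  have comp: "component gr (es ! i) = (\<lambda>d. if d = ds ! i then es ! i else 0)"
    and nz: "es ! i \<noteq> 0" if "i < length es" for i
    using assms(1) False that
    by (auto simp: homogeneous_def list_all2_conv_all_nth component_homogeneous in_set_conv_nth)
  have len: "length es = length ds"
    using assms(1) by (simp add: homogeneous_def list_all2_lengthD)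
  have "{ds'. list_all2 (\<lambda>e d. component gr e d \<noteq> 0) es ds'} = {ds}"
    using len comp nz by (auto simp: list_all2_conv_all_nth intro!: nth_equalityI split: if_splits)
  moreover have "map2 (component gr) es ds = es"
    using len comp by (auto intro!: nth_equalityI)
  ultimately show ?thesis
    by (simp add: extend_def)
qed

end

text \<open>A zero pair at position \<open>j\<close> kills every summand: summand \<open>j\<close>
  through its last argument \<open>hs ! j\<close>, every other one through \<open>xs ! j\<close>,
  which survives the omission of entry \<open>i\<close>. This provides the vanishing that
  \<open>extend_homogeneous\<close> asks for.\<close>

lemma (in graded_action_maps) action_sum_zero:
  assumes "length xs = k" "length hs = k" "(0, 0) \<in> set (zip xs hs)"
  shows "action_sum sH rho k ds xs hs = 0"
  unfolding action_sum_def
proof (rule sum.neutral, rule ballI)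
  fix i assume "i \<in> {..<k}"
  then have i: "i < k" and k: "k \<ge> 1" by auto
  obtain j where j: "j < k" "xs ! j = 0" "hs ! j = 0"
    using assms by (auto simp: in_set_conv_nth)
  let ?ys = "take i xs @ drop (Suc i) xs"
  have ys: "length ?ys = k - 1"
    using i assms(1) by simp
  have "rho k ?ys (hs ! i) = 0"
  proof (cases "i = j")
    case True
    interpret Vector_Spaces.linear sH sH "rho k ?ys"
      using act_linear[OF k ys] .
    show ?thesis
      using True j zero by simp
  next
    case False
    have "0 \<in> set ?ys"
    proof (cases "j < i")
      case True
      then have "?ys ! j = 0"
        using i j assms(1) by (simp add: nth_append)
      moreover have "j < length ?ys" using True i ys by simp
      ultimately show ?thesis by (metis nth_mem)
    next
      \<comment> \<open>Here \<open>j > i\<close>, so the zero lies in the part after the omitted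
        entry, at offset \<open>j - Suc i\<close>.\<close>
      case nless: False
      then have "xs ! j = drop (Suc i) xs ! (j - Suc i)" "j - Suc i < length (drop (Suc i) xs)"
        using False i j assms(1) by auto
      then show ?thesis using j by (metis Un_iff nth_mem set_append)
    qed
    then show ?thesis
      using multilinear_zero[OF act_multilinear[OF k] ys] by blast
  qed
  then show "sH ((-1) ^ (k - 1 - i) * (-1) powi (ds ! i * sum_list (drop (Suc i) ds)))
      (rho k ?ys (hs ! i)) = 0"
    by (simp add: H.scale_zero_right)
qed

lemma jacobi_sum_add:
  assumes "vector_space s"
  shows "jacobi_sum s N ds xs (\<lambda>k l ys. F k l ys + G k l ys) =
    jacobi_sum s N ds xs F + jacobi_sum s N ds xs G"
proof -
  interpret vector_space s by fact
  show ?thesis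
    by (simp add: jacobi_sum_def scale_right_distrib sum.distrib case_prod_unfold)
qed

text \<open>Permuting keeps the length, so agreement on lists of length \<open>N\<close> is enough.
  The restriction matters because the structure maps are multilinear only on lists of the right
  length.\<close>

lemma jacobi_sum_cong:
  assumes "length xs = N"
    and "\<And>k l ys. \<lbrakk>k \<ge> 1; l \<ge> 1; k + l = N + 1; length ys = N\<rbrakk> \<Longrightarrow> F k l ys = G k l ys"
  shows "jacobi_sum s N ds xs F = jacobi_sum s N ds xs G"
  unfolding jacobi_sum_def
  by (intro sum.cong refl) (auto simp: assms intro!: sum.cong)

lemma L_infinity_algebra_add:
  fixes s :: "'k::field_char_0 \<Rightarrow> 'v::ab_group_add \<Rightarrow> 'v"
  assumes "L_infinity_algebra s gr f" "L_infinity_algebra s gr g"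
    and mixed: "\<And>N xs ds. \<lbrakk>N \<ge> 1; length xs = N; homogeneous gr xs ds\<rbrakk> \<Longrightarrow>
      jacobi_sum s N ds xs (\<lambda>k l ys. nest f g k l ys + nest g f k l ys) = 0"
  shows "L_infinity_algebra s gr (\<lambda>k xs. f k xs + g k xs)"
proof -
  interpret f: L_infinity_algebra s gr f by fact
  interpret g: L_infinity_algebra s gr g by fact
  let ?l = "\<lambda>k xs. f k xs + g k xs"
  show ?thesis
  proof
    show "multilinear k s s (?l k)" if "k \<ge> 1" for k
      using that by (intro multilinear_plus f.mu_multilinear g.mu_multilinear)
    show "?l k xs \<in> gr (sum_list ds + int k - 2)"
      if "k \<ge> 1" "length xs = k" "homogeneous gr xs ds" for k xs ds
      using that by (intro f.subspace_add f.subspace_gr f.mu_degree g.mu_degree)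
    show "?l k xs = s (skew_sign \<sigma> ds) (?l k (permute_list \<sigma> xs))"
      if "k \<ge> 1" "length xs = k" "homogeneous gr xs ds" "\<sigma> permutes {..<k}" for k xs ds \<sigma>
      using f.mu_skew[OF that] g.mu_skew[OF that] by (simp add: f.scale_right_distrib)
    show "jacobi_sum s N ds xs (nest ?l ?l) = 0"
      if N: "N \<ge> 1" "length xs = N" "homogeneous gr xs ds" for N xs ds
    proof -
      have "jacobi_sum s N ds xs (nest ?l ?l) = jacobi_sum s N ds xs (\<lambda>k l ys.
          nest f f k l ys + nest g g k l ys + (nest f g k l ys + nest g f k l ys))"
      proof (rule jacobi_sum_cong[OF N(2)])
        fix k l and ys :: "'v list"
        assume kl: "k \<ge> 1" "l \<ge> 1" "k + l = N + 1" "length ys = N"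
        \<comment> \<open>The outer map receives one inner value and \<open>N - l = k - 1\<close>
          further inputs, so its additivity in the first slot applies.\<close>
        then have "Suc (length (drop l ys)) = k" by simp
        note add = multilinear_Cons_add[OF f.mu_multilinear[OF kl(1)] this]
          multilinear_Cons_add[OF g.mu_multilinear[OF kl(1)] this]
        show "nest ?l ?l k l ys =
            nest f f k l ys + nest g g k l ys + (nest f g k l ys + nest g f k l ys)"
          by (simp add: nest_def add algebra_simps)
      qed
      also have "\<dots> = 0"
        by (simp add: jacobi_sum_add f.vector_space_axioms f.mu_jacobi[OF N] g.mu_jacobi[OF N]
            mixed[OF N, unfolded jacobi_sum_add[OF f.vector_space_axioms]])
      finally show ?thesis .
    qed
  qed
qed

text \<open>The index set of \<open>extend\<close> depends on the inputs and the grading only, so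
  the three extensions are sums over the same set and can be compared termwise, on arbitrary
  inputs.\<close>

lemma matched_sum_eq_add:
  "matched_sum sG gG sH gH mu nu rho psi =
    (\<lambda>k es. left_semidirect gG sH gH mu rho k es + right_semidirect sG gG gH psi nu k es)"
  by (intro ext) (simp add: matched_sum_def left_semidirect_def right_semidirect_def extend_def
      sum.distrib[symmetric] add.commute)

theorem theorem6p12:
  fixes sG :: "'k::field_char_0 \<Rightarrow> 'g::ab_group_add \<Rightarrow> 'g" and gG :: "int \<Rightarrow> 'g set"
    and sH :: "'k \<Rightarrow> 'h::ab_group_add \<Rightarrow> 'h" and gH :: "int \<Rightarrow> 'h set"
    and mu :: "nat \<Rightarrow> 'g list \<Rightarrow> 'g" and nu :: "nat \<Rightarrow> 'h list \<Rightarrow> 'h"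
    and rho :: "nat \<Rightarrow> 'g list \<Rightarrow> 'h \<Rightarrow> 'h" and psi :: "nat \<Rightarrow> 'h list \<Rightarrow> 'g \<Rightarrow> 'g"
  assumes "matched_pair sG gG mu sH gH nu rho psi"
  shows "L_infinity_algebra (module_prod.scale sG sH) (gr_prod gG gH)
           (matched_sum sG gG sH gH mu nu rho psi) \<and>
         (\<forall>k \<ge> 1. \<forall>ds xs hs.
           length xs = k \<and> length hs = k \<and> homogeneous gG xs ds \<and> homogeneous gH hs ds \<longrightarrow>
           matched_sum sG gG sH gH mu nu rho psi k (zip xs hs) =
             (mu k xs + (\<Sum>i<k. sG ((-1) ^ (k - 1 - i) * (-1) powi (ds ! i * sum_list (drop (Suc i) ds)))
                                  (psi k (take i hs @ drop (Suc i) hs) (xs ! i))),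
              nu k hs + (\<Sum>i<k. sH ((-1) ^ (k - 1 - i) * (-1) powi (ds ! i * sum_list (drop (Suc i) ds)))
                                  (rho k (take i xs @ drop (Suc i) xs) (hs ! i)))))"
proof -
  interpret matched_pair sG gG mu sH gH nu rho psi by fact
  \<comment> \<open>This makes the direct sum available as a graded vector space, the setting of
    \<open>extend_homogeneous\<close>.\<close>
  interpret P: L_infinity_algebra "module_prod.scale sG sH" "gr_prod gG gH"
      "left_semidirect gG sH gH mu rho"
    by (rule rho_representation)
  have "L_infinity_algebra (module_prod.scale sG sH) (gr_prod gG gH)
      (matched_sum sG gG sH gH mu nu rho psi)"
    unfolding matched_sum_eq_add
    by (rule L_infinity_algebra_add[OF rho_representation psi_representation compatibility])
  moreover have "matched_sum sG gG sH gH mu nu rho psi k (zip xs hs) =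
      (mu k xs + action_sum sG psi k ds hs xs, nu k hs + action_sum sH rho k ds xs hs)"
    if "k \<ge> 1" and len: "length xs = k" "length hs = k"
      and "homogeneous gG xs ds" "homogeneous gH hs ds" for k ds xs hs
  proof -
    have hom: "homogeneous (gr_prod gG gH) (zip xs hs) ds"
      using that by (auto simp: homogeneous_def list_all2_conv_all_nth gr_prod_def)
    let ?f = "\<lambda>ds es. (mu k (map fst es) + action_sum sG psi k ds (map snd es) (map fst es),
      nu k (map snd es) + action_sum sH rho k ds (map fst es) (map snd es))"
    \<comment> \<open>A zero of the direct sum is a pair \<open>(0, 0)\<close>. It annihilates
      \<open>mu\<close> and \<open>nu\<close> by multilinearity and both action sums by
      \<open>action_sum_zero\<close>.\<close>
    have "?f ds (zip xs hs) = 0" if z: "0 \<in> set (zip xs hs)"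
    proof -
      have "0 \<in> set xs" "0 \<in> set hs" and xh: "(0, 0) \<in> set (zip xs hs)"
        using z by (auto simp: zero_prod_def dest: set_zip_leftD set_zip_rightD)
      then have "mu k xs = 0" "nu k hs = 0"
        using multilinear_zero[OF G.mu_multilinear] multilinear_zero[OF H.mu_multilinear]
          \<open>k \<ge> 1\<close> len by blast+
      \<comment> \<open>For \<open>psi\<close> the two spaces exchange roles, so the zero pair is
        needed in the swapped order.\<close>
      moreover have "(0, 0) \<in> set (zip hs xs)"
        using xh len by (auto simp: in_set_zip)
      ultimately show ?thesis
        using xh len by (simp add: rho.action_sum_zero psi.action_sum_zero zero_prod_def)
    qed
    from P.extend_homogeneous[OF hom, of ?f, OF this] show ?thesis
      using len by (simp add: matched_sum_def)
  qed
  ultimately show ?thesis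
    unfolding action_sum_def by blast
qed

end
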